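(* In the partition-wise setting of the context, any optimal solution to $$\max_{z\in\mathbb{R}^N}\ \min_{(a,b)\in\mathcal{A}}\ \frac{\sum_{n=1}^N z_nG^n(Y^n|z_n,a^n,b^n)}{1+\sum_{n=1}^N G^n(Y^n|z_n,a^n,b^n)}$$ is also optimal to $$\max_{z\in\mathbb{R}^N}\ \frac{\sum_{n=1}^N z_n\underline{\mathcal{G}}^n(z_n)}{1+\sum_{n=1}^N\underline{\mathcal{G}}^n(z_n)},$$ and vice versa.
   Context: A GEV choice probability generating function (CPGF) on $k$ products is a smooth function $G$ of vectors $Y=(Y_1,\dots,Y_k)$ with positive entries such that: (i) $G(Y)\ge 0$; (ii) $G(\lambda Y)=\lambda G(Y)$ for $\lambda>0$; (iii) $G(Y)\to\infty$ if $Y_i\to\infty$; (iv) for distinct indices $i_1,\dots,i_j$, the mixed partial derivative $\partial G_{i_1,\dots,i_j}(Y)$ is $>0$ if $j$ is odd and $\le 0$ if $j$ is even. (Consequently $G(Y)=\sum_i Y_i\partial G_i(Y)$ and $\sum_j Y_j\partial G_{ij}(Y)=0$ for all $i$.) Partition-wise setting: the products $\mathcal{V}=\{1,\dots,m\}$, with costs $c\in\mathbb{R}^m$, are partitioned into nonempty disjoint subsets $\mathcal{V}_1,\dots,\mathcal{V}_N$. For each $n$, $G^n$ is a CPGF in the variables $Y^n=(Y_i)_{i\in\mathcal{V}_n}$. The uncertainty set is $\mathcal{A}=\mathcal{A}^1\times\dots\times\mathcal{A}^N$ with each $\mathcal{A}^n\subset\mathbb{R}^{2|\mathcal{V}_n|}$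 nonempty, convex and compact, and for every $(a^n,b^n)\in\mathcal{A}^n$ the entries of $b^n=(b_i)_{i\in\mathcal{V}_n}$ are all equal and positive. For $z_n\in\mathbb{R}$, $G^n(Y^n|z_n,a^n,b^n):=G^n\big((e^{a_i-b_i(z_n+c_i)})_{i\in\mathcal{V}_n}\big)$, and $\underline{\mathcal{G}}^n(z_n)=\min_{(a^n,b^n)\in\mathcal{A}^n}G^n(Y^n|z_n,a^n,b^n)$. *)

theory Defs
  imports "HOL-Analysis.Analysis"
begin

text \<open>
  Products are the elements of the finite type \<open>'p\<close>. For a set \<open>I\<close> of products, the space of real
  vectors indexed by \<open>I\<close> is represented by the coordinate subspace of vectors that vanish
  outside \<open>I\<close>, so that convexity, compactness and continuity are the usual ones.
\<close>

definition coord_space :: "'p::finite set \<Rightarrow> (real ^ 'p) set"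
  where "coord_space I = {x. \<forall>i. i \<notin> I \<longrightarrow> x $ i = 0}"

definition coord_proj :: "'p::finite set \<Rightarrow> real ^ 'p \<Rightarrow> real ^ 'p"
  where "coord_proj I x = (\<chi> i. if i \<in> I then x $ i else 0)"

definition pos_orthant :: "'p::finite set \<Rightarrow> (real ^ 'p) set"
  where "pos_orthant I = {Y \<in> coord_space I. \<forall>i\<in>I. 0 < Y $ i}"

definition partial_deriv :: "'p::finite \<Rightarrow> (real ^ 'p \<Rightarrow> real) \<Rightarrow> real ^ 'p \<Rightarrow> real"
  where "partial_deriv i F Y = deriv (\<lambda>t. F (Y + t *\<^sub>R axis i 1)) 0"

definition partial_derivs :: "'p::finite list \<Rightarrow> (real ^ 'p \<Rightarrow> real) \<Rightarrow> real ^ 'p \<Rightarrow> real"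
  where "partial_derivs is F = foldr partial_deriv is F"

text \<open>
  Smooth means \<open>C\<^sup>\<infinity>\<close> in the variables indexed by \<open>I\<close>: all iterated partial derivatives
  exist and are continuous on the positive orthant. Only the values of \<open>F\<close> on that orthant matter.
\<close>

definition smooth_on_orthant :: "'p::finite set \<Rightarrow> (real ^ 'p \<Rightarrow> real) \<Rightarrow> bool"
  where "smooth_on_orthant I F \<longleftrightarrow>
    (\<forall>is\<in>lists I.
       continuous_on (pos_orthant I) (partial_derivs is F) \<and>
       (\<forall>i\<in>I. \<forall>Y\<in>pos_orthant I.
          (\<lambda>t. partial_derivs is F (Y + t *\<^sub>R axis i 1)) field_differentiable (at 0)))"

text \<open>
  Divergence is along one coordinate at a time, the others being held fixed. In the sign
  conditions the order of differentiation is immaterial, since \<open>F\<close> is smooth.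
\<close>

definition cpgf :: "'p::finite set \<Rightarrow> (real ^ 'p \<Rightarrow> real) \<Rightarrow> bool"
  where "cpgf I F \<longleftrightarrow>
    smooth_on_orthant I F \<and>
    (\<forall>Y\<in>pos_orthant I. 0 \<le> F Y) \<and>
    (\<forall>Y\<in>pos_orthant I. \<forall>r>0. F (r *\<^sub>R Y) = r * F Y) \<and>
    (\<forall>i\<in>I. \<forall>Y\<in>pos_orthant I.
       filterlim (\<lambda>t. F (\<chi> j. if j = i then t else Y $ j)) at_top at_top) \<and>
    (\<forall>is. distinct is \<longrightarrow> set is \<subseteq> I \<longrightarrow> odd (length is) \<longrightarrow>
       (\<forall>Y\<in>pos_orthant I. 0 < partial_derivs is F Y)) \<and>
    (\<forall>is. distinct is \<longrightarrow> set is \<subseteq> I \<longrightarrow> is \<noteq> [] \<longrightarrow> even (length is) \<longrightarrow>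
       (\<forall>Y\<in>pos_orthant I. partial_derivs is F Y \<le> 0))"

definition utility_vec ::
    "'p::finite set \<Rightarrow> real ^ 'p \<Rightarrow> real \<Rightarrow> real ^ 'p \<Rightarrow> real ^ 'p \<Rightarrow> real ^ 'p"
  where "utility_vec I c \<zeta> a b =
    (\<chi> i. if i \<in> I then exp (a $ i - b $ i * (\<zeta> + c $ i)) else 0)"

definition min_over :: "'a set \<Rightarrow> ('a \<Rightarrow> real) \<Rightarrow> real"
  where "min_over S f = (LEAST v. v \<in> f ` S)"

definition product_uncertainty ::
    "('n \<Rightarrow> 'p::finite set) \<Rightarrow> ('n \<Rightarrow> ((real ^ 'p) \<times> (real ^ 'p)) set) \<Rightarrow> ((real ^ 'p) \<times> (real ^ 'p)) set"
  where "product_uncertainty V A =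
    {(a, b). \<forall>n. (coord_proj (V n) a, coord_proj (V n) b) \<in> A n}"

definition worst_G ::
    "'p::finite set \<Rightarrow> real ^ 'p \<Rightarrow> (real ^ 'p \<Rightarrow> real) \<Rightarrow> ((real ^ 'p) \<times> (real ^ 'p)) set \<Rightarrow> real \<Rightarrow> real"
  where "worst_G I c F S \<zeta> = min_over S (\<lambda>(a, b). F (utility_vec I c \<zeta> a b))"

definition robust_objective ::
    "('n::finite \<Rightarrow> 'p::finite set) \<Rightarrow> real ^ 'p \<Rightarrow> ('n \<Rightarrow> real ^ 'p \<Rightarrow> real) \<Rightarrow>
     ('n \<Rightarrow> ((real ^ 'p) \<times> (real ^ 'p)) set) \<Rightarrow> real ^ 'n \<Rightarrow> real"
  where "robust_objective V c G A z =
    min_over (product_uncertainty V A)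
      (\<lambda>(a, b). (\<Sum>n\<in>UNIV. z $ n * G n (utility_vec (V n) c (z $ n) a b)) /
                (1 + (\<Sum>n\<in>UNIV. G n (utility_vec (V n) c (z $ n) a b))))"

definition worst_G_objective ::
    "('n::finite \<Rightarrow> 'p::finite set) \<Rightarrow> real ^ 'p \<Rightarrow> ('n \<Rightarrow> real ^ 'p \<Rightarrow> real) \<Rightarrow>
     ('n \<Rightarrow> ((real ^ 'p) \<times> (real ^ 'p)) set) \<Rightarrow> real ^ 'n \<Rightarrow> real"
  where "worst_G_objective V c G A z =
    (\<Sum>n\<in>UNIV. z $ n * worst_G (V n) c (G n) (A n) (z $ n)) /
    (1 + (\<Sum>n\<in>UNIV. worst_G (V n) c (G n) (A n) (z $ n)))"

end

theory Submission
  imports Defs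
begin

text \<open>
  For positive weights \<open>q\<^sub>n\<close>, the revenue \<open>(\<Sum>n. z\<^sub>n q\<^sub>n) / (1 + (\<Sum>n. q\<^sub>n))\<close> is at least \<open>v\<close> iff
  \<open>(\<Sum>n. (z\<^sub>n - v) q\<^sub>n) \<ge> v\<close>. Since the uncertainty set is a product, the minima of all the \<open>G\<^sup>n\<close> are
  attained simultaneously, so the robust objective \<open>R\<close> is below the objective \<open>W\<close> built from these
  minima. Conversely, raising every price below \<open>u = W z\<close> to \<open>u\<close> only increases each
  \<open>(z\<^sub>n - u) q\<^sub>n\<close>; all coefficients \<open>z\<^sub>n - u\<close> are then nonnegative, so the worst case is
  the one minimising every \<open>G\<^sup>n\<close>, and \<open>R\<close> at the raised prices is at least \<open>W z\<close>. If \<open>z\<close> maximises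
  \<open>W\<close>, no price is below \<open>u\<close>, since raising it would strictly increase \<open>W\<close>.
\<close>

section \<open>Comparing worst-case and nominal revenue for positive weights\<close>

definition revenue :: "real ^ 'n::finite \<Rightarrow> ('n \<Rightarrow> real) \<Rightarrow> real"
  where "revenue z q = (\<Sum>n\<in>UNIV. z $ n * q n) / (1 + (\<Sum>n\<in>UNIV. q n))"

lemma le_revenue_iff:
  assumes "\<And>n. 0 < q n"
  shows "v \<le> revenue z q \<longleftrightarrow> v \<le> (\<Sum>n\<in>UNIV. (z $ n - v) * q n)"
proof -
  have "0 < 1 + (\<Sum>n\<in>UNIV. q n)"
    using assms by (simp add: add_pos_nonneg sum_nonneg less_imp_le)
  then show ?thesis
    by (simp add: revenue_def pos_le_divide_eq left_diff_distrib sum_subtractf distrib_left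
        sum_distrib_left[symmetric] le_diff_eq)
qed

lemma revenue_le_iff:
  assumes "\<And>n. 0 < q n"
  shows "revenue z q \<le> v \<longleftrightarrow> (\<Sum>n\<in>UNIV. (z $ n - v) * q n) \<le> v"
proof -
  have "0 < 1 + (\<Sum>n\<in>UNIV. q n)"
    using assms by (simp add: add_pos_nonneg sum_nonneg less_imp_le)
  then show ?thesis
    by (simp add: revenue_def pos_divide_le_eq left_diff_distrib sum_subtractf distrib_left
        sum_distrib_left[symmetric] diff_le_eq)
qed

text \<open>The core of the equivalence, freed from GEV functions: \<open>P\<close> is an abstract
  set of scenarios and \<open>R\<close> an attained lower bound of the revenue over it. The product
  structure survives only as \<open>w_attained\<close>, which asks for one scenario minimising every
  \<open>g n\<close> at the given prices.\<close>

lemma is_arg_max_min_revenue_iff: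
  fixes g :: "'n::finite \<Rightarrow> real \<Rightarrow> 's \<Rightarrow> real"
    and w :: "'n \<Rightarrow> real \<Rightarrow> real"
    and R :: "real ^ 'n \<Rightarrow> real"
  assumes g_pos: "\<And>n x s. 0 < g n x s"
    and R_attained: "\<And>z. \<exists>s\<in>P. R z = revenue z (\<lambda>n. g n (z $ n) s)"
    and R_le: "\<And>z s. s \<in> P \<Longrightarrow> R z \<le> revenue z (\<lambda>n. g n (z $ n) s)"
    and w_attained: "\<And>z. \<exists>s\<in>P. \<forall>n. w n (z $ n) = g n (z $ n) s"
    and w_le: "\<And>n x s. s \<in> P \<Longrightarrow> w n x \<le> g n x s"
  shows "is_arg_max R (\<lambda>_. True) z \<longleftrightarrow>
         is_arg_max (\<lambda>z. revenue z (\<lambda>n. w n (z $ n))) (\<lambda>_. True) z"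
proof -
  define W where "W z = revenue z (\<lambda>n. w n (z $ n))" for z
  have w_pos: "0 < w n x" for n x
    \<comment> \<open>The constant price vector turns attainment at a price vector into a statement
      about a single price \<open>x\<close>.\<close>
    using w_attained[of "\<chi> n. x"] g_pos by (metis vec_lambda_beta)
  have R_le_W: "R z \<le> W z" for z
    using w_attained[of z] R_le[of _ z] by (auto simp: W_def)
  have le_R: "u \<le> R z"
    if "\<And>n. u \<le> z $ n" and "u \<le> (\<Sum>n\<in>UNIV. (z $ n - u) * w n (z $ n))" for u z
  proof -
    \<comment> \<open>At a worst scenario \<open>s\<close> the weights are at least
      \<open>w\<close>, and the coefficients \<open>z $ n - u\<close> are nonnegative, so passing
      from \<open>w\<close> to \<open>g\<close> can only enlarge the sum.\<close>
    obtain s where s: "s \<in> P" "R z = revenue z (\<lambda>n. g n (z $ n) s)"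
      using R_attained by blast
    have "(\<Sum>n\<in>UNIV. (z $ n - u) * w n (z $ n)) \<le> (\<Sum>n\<in>UNIV. (z $ n - u) * g n (z $ n) s)"
      by (intro sum_mono mult_left_mono) (use that(1) w_le s(1) in auto)
    then have "u \<le> (\<Sum>n\<in>UNIV. (z $ n - u) * g n (z $ n) s)"
      using that(2) by linarith
    then show ?thesis
      using s(2) g_pos by (simp add: le_revenue_iff)
  qed
  have W_le: "W z \<le> (\<Sum>n\<in>UNIV. (z $ n - W z) * w n (z $ n))" for z
    using le_revenue_iff[of "\<lambda>n. w n (z $ n)" "W z" z] w_pos by (simp add: W_def)
  \<comment> \<open>A price at or above \<open>u\<close> is left alone; below \<open>u\<close>, a
    negative term is replaced by zero, whatever the weight at the new price is.\<close>
  have raise: "(z $ n - u) * w n (z $ n) \<le>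
      ((\<chi> n. max (z $ n) u) $ n - u) * w n ((\<chi> n. max (z $ n) u) $ n)" for z u n
    using w_pos[of n "z $ n"] by (auto simp: max_def mult_le_0_iff)
  have W_le_R_raised: "W z \<le> R (\<chi> n. max (z $ n) (W z))" for z
    by (rule le_R[OF _ order.trans[OF W_le sum_mono[OF raise]]]) simp
  have prices_ge: "W z \<le> z $ n" if max: "\<And>y. W y \<le> W z" for z n
  proof (rule ccontr)
    assume less: "\<not> W z \<le> z $ n"
    \<comment> \<open>Term \<open>n\<close> strictly increases under raising and no other term
      decreases, so the sum at \<open>y\<close> exceeds \<open>W z\<close>, contradicting
      maximality.\<close>
    define y where "y = (\<chi> n. max (z $ n) (W z))"
    have "(z $ n - W z) * w n (z $ n) < 0"
      using less w_pos by (simp add: mult_less_0_iff)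
    moreover have "y $ n = W z"
      using less by (simp add: y_def)
    ultimately have "(z $ n - W z) * w n (z $ n) < (y $ n - W z) * w n (y $ n)"
      by simp
    then have "(\<Sum>n\<in>UNIV. (z $ n - W z) * w n (z $ n)) < (\<Sum>n\<in>UNIV. (y $ n - W z) * w n (y $ n))"
      using raise by (intro sum_strict_mono_ex1) (auto simp: y_def)
    then have "\<not> W y \<le> W z"
      using W_le[of z] revenue_le_iff[of "\<lambda>n. w n (y $ n)" y "W z"] w_pos by (simp add: W_def)
    with max show False by blast
  qed
  have "(\<forall>y. R y \<le> R z) \<longleftrightarrow> (\<forall>y. W y \<le> W z)"
  proof
    assume "\<forall>y. R y \<le> R z"
    \<comment> \<open>With \<open>y'\<close> denoting \<open>y\<close> raised to \<open>W y\<close>,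
      the chain is \<open>W y \<le> R y' \<le> R z \<le> W z\<close>.\<close>
    then show "\<forall>y. W y \<le> W z"
      using R_le_W W_le_R_raised by (meson order.trans)
  next
    assume max: "\<forall>y. W y \<le> W z"
    then have "W z \<le> R z"
      using le_R[OF prices_ge W_le] by blast
    then show "\<forall>y. R y \<le> R z"
      using max R_le_W by (meson order.trans)
  qed
  then show ?thesis
    by (simp add: is_arg_max_linorder flip: W_def)
qed

section \<open>Attained minima, and positivity and continuity of CPGFs\<close>

text \<open>\<open>min_over\<close> is a \<open>LEAST\<close> over the reals, which is informative
  only once a least value exists; compactness and continuity supply it.\<close>

lemma min_over_compact:
  fixes f :: "'a::topological_space \<Rightarrow> real"
  assumes "compact S" and "S \<noteq> {}" and "continuous_on S f"
  shows min_over_attained: "\<exists>x\<in>S. min_over S f = f x"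
    and min_over_le: "x \<in> S \<Longrightarrow> min_over S f \<le> f x"
proof -
  obtain x0 where x0: "x0 \<in> S" "\<And>y. y \<in> S \<Longrightarrow> f x0 \<le> f y"
    using continuous_attains_inf[OF assms] by blast
  have "min_over S f = f x0"
    unfolding min_over_def
  proof (rule Least_equality)
    show "f x0 \<in> f ` S"
      using x0(1) by (rule imageI)
    show "f x0 \<le> v" if "v \<in> f ` S" for v
      using that x0(2) by blast
  qed
  then show "\<exists>x\<in>S. min_over S f = f x" and "x \<in> S \<Longrightarrow> min_over S f \<le> f x"
    using x0(1) x0(2)[of x] by (blast, simp)
qed

text \<open>The axioms give only nonnegativity, while the revenue comparison needs positive weights.
  Positive first partials make \<open>F\<close> strictly increasing in coordinate \<open>i\<close>,
  so \<open>F Y\<close> exceeds a nonnegative value at a point with smaller coordinate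
  \<open>i\<close>.\<close>

lemma cpgf_pos:
  assumes F: "cpgf I F" and "i \<in> I" and Y: "Y \<in> pos_orthant I"
  shows "0 < F Y"
proof -
  let ?L = "\<lambda>t. Y + t *\<^sub>R axis i 1"
  have orthant: "?L t \<in> pos_orthant I" if "- Y $ i < t" for t
    using Y \<open>i \<in> I\<close> that by (auto simp: pos_orthant_def coord_space_def axis_def)
  have deriv: "((\<lambda>t. F (?L t)) has_real_derivative partial_deriv i F (?L t)) (at t)"
    and deriv_pos: "0 < partial_deriv i F (?L t)" if "- Y $ i < t" for t
  proof -
    \<comment> \<open>Smoothness provides derivatives at offset 0 only, so it is used at the base
      point \<open>?L t\<close> and the result is shifted to \<open>t\<close>.\<close>
    have "(\<lambda>s. partial_derivs [] F (?L t + s *\<^sub>R axis i 1)) field_differentiable (at 0)"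
      using F orthant[OF that] \<open>i \<in> I\<close> by (auto simp: cpgf_def smooth_on_orthant_def)
    then have "((\<lambda>s. F (?L t + s *\<^sub>R axis i 1)) has_real_derivative partial_deriv i F (?L t)) (at 0)"
      by (simp add: partial_derivs_def partial_deriv_def DERIV_deriv_iff_field_differentiable)
    then show "((\<lambda>t. F (?L t)) has_real_derivative partial_deriv i F (?L t)) (at t)"
      using DERIV_shift[of "\<lambda>t. F (?L t)" "partial_deriv i F (?L t)" 0 t]
      by (simp add: algebra_simps scaleR_add_left)
    have "0 < partial_derivs [i] F (?L t)"
      using F orthant[OF that] \<open>i \<in> I\<close> by (simp add: cpgf_def)
    then show "0 < partial_deriv i F (?L t)"
      by (simp add: partial_derivs_def)
  qed
  have "0 < Y $ i"
    using Y \<open>i \<in> I\<close> by (simp add: pos_orthant_def)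
  \<comment> \<open>This offset halves coordinate \<open>i\<close>, which keeps the point in the
    orthant.\<close>
  have "0 \<le> F (?L (- Y $ i / 2))"
    using F orthant[of "- Y $ i / 2"] \<open>0 < Y $ i\<close> by (simp add: cpgf_def)
  also have "\<dots> < F (?L 0)"
  proof (rule DERIV_pos_imp_increasing[of "- Y $ i / 2" 0 "\<lambda>t. F (?L t)"])
    show "\<exists>D. ((\<lambda>t. F (?L t)) has_real_derivative D) (at t) \<and> 0 < D" if "- Y $ i / 2 \<le> t" for t
      using deriv[of t] deriv_pos[of t] that \<open>0 < Y $ i\<close> by fastforce
  qed (use \<open>0 < Y $ i\<close> in auto)
  finally show ?thesis
    by simp
qed

lemma utility_vec_in_pos_orthant: "utility_vec I c \<zeta> a b \<in> pos_orthant I"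
  by (auto simp: utility_vec_def pos_orthant_def coord_space_def)

lemma utility_vec_coord_proj:
  "utility_vec I c \<zeta> (coord_proj I a) (coord_proj I b) = utility_vec I c \<zeta> a b"
  by (simp add: utility_vec_def coord_proj_def vec_eq_iff)

lemma continuous_on_cpgf_utility_vec:
  assumes "cpgf I F"
  shows "continuous_on S (\<lambda>s. F (utility_vec I c \<zeta> (fst s) (snd s)))"
proof (rule continuous_on_compose2[of "pos_orthant I" F])
  have "continuous_on (pos_orthant I) (partial_derivs [] F)"
    using assms by (simp add: cpgf_def smooth_on_orthant_def)
  then show "continuous_on (pos_orthant I) F"
    by (simp add: partial_derivs_def)
  have "continuous_on S (\<lambda>s. if i \<in> I then exp (fst s $ i - snd s $ i * (\<zeta> + c $ i)) else 0)" for i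
    by (cases "i \<in> I"; simp)
      (intro continuous_on_exp continuous_on_diff continuous_on_mult continuous_on_const
        continuous_on_component continuous_on_fst continuous_on_snd continuous_on_id)
  then show "continuous_on S (\<lambda>s. utility_vec I c \<zeta> (fst s) (snd s))"
    unfolding utility_vec_def by (rule continuous_on_vec_lambda)
qed (simp add: image_subset_iff utility_vec_in_pos_orthant)

section \<open>Decomposing and gluing scenarios along the partition\<close>

lemma coord_proj_sum:
  fixes V :: "'n::finite \<Rightarrow> 'p::finite set"
  assumes "disjoint_family V" and "(\<Union>n. V n) = UNIV"
  shows "(\<Sum>n\<in>UNIV. coord_proj (V n) x) = x"
proof (subst vec_eq_iff, rule allI)
  fix i
  obtain m where m: "i \<in> V m"
    using assms(2) by blast
  then have "i \<in> V n \<longleftrightarrow> n = m" for n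
    using assms(1) by (auto simp: disjoint_family_on_def)
  then show "(\<Sum>n\<in>UNIV. coord_proj (V n) x) $ i = x $ i"
    by (simp add: coord_proj_def)
qed

lemma coord_proj_glue:
  fixes V :: "'n::finite \<Rightarrow> 'p::finite set"
  assumes "disjoint_family V" and "\<And>n. f n \<in> coord_space (V n)"
  shows "coord_proj (V m) (\<Sum>n\<in>UNIV. f n) = f m"
proof (subst vec_eq_iff, rule allI)
  fix i
  have "(\<Sum>n\<in>UNIV. f n $ i) = (\<Sum>n\<in>UNIV. if n = m then f n $ i else 0)" if "i \<in> V m"
  proof (intro sum.cong refl)
    show "f n $ i = (if n = m then f n $ i else 0)" for n
      using assms(1) assms(2)[of n] that by (auto simp: coord_space_def disjoint_family_on_def)
  qed
  then show "coord_proj (V m) (\<Sum>n\<in>UNIV. f n) $ i = f m $ i"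
    using assms(2)[of m] by (auto simp: coord_proj_def coord_space_def)
qed

text \<open>Blocks can be chosen independently: they have disjoint supports, so their sum projects
  back to each of them. This is what makes simultaneous minimisation possible.\<close>

lemma product_uncertainty_glue:
  fixes V :: "'n::finite \<Rightarrow> 'p::finite set"
  assumes "disjoint_family V" and "\<And>n. A n \<subseteq> coord_space (V n) \<times> coord_space (V n)"
    and "\<And>n. s n \<in> A n"
  shows "\<exists>p\<in>product_uncertainty V A. \<forall>n. (coord_proj (V n) (fst p), coord_proj (V n) (snd p)) = s n"
proof
  let ?p = "(\<Sum>n\<in>UNIV. fst (s n), \<Sum>n\<in>UNIV. snd (s n))"
  have "fst (s n) \<in> coord_space (V n)" "snd (s n) \<in> coord_space (V n)" for n
    using assms(2)[of n] assms(3)[of n] by (auto simp: mem_Times_iff)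
  then show proj: "\<forall>n. (coord_proj (V n) (fst ?p), coord_proj (V n) (snd ?p)) = s n"
    using assms(1) by (simp add: coord_proj_glue)
  then show "?p \<in> product_uncertainty V A"
    using assms(3) by (simp add: product_uncertainty_def)
qed

text \<open>Closed as an intersection of preimages under continuous projections; bounded because
  each point is the sum of its blocks, whose norms are bounded separately.\<close>

lemma compact_product_uncertainty:
  fixes V :: "'n::finite \<Rightarrow> 'p::finite set"
  assumes "disjoint_family V" and "(\<Union>n. V n) = UNIV" and compact: "\<And>n. compact (A n)"
  shows "compact (product_uncertainty V A)"
proof -
  define \<pi> :: "'n \<Rightarrow> (real ^ 'p) \<times> (real ^ 'p) \<Rightarrow> (real ^ 'p) \<times> (real ^ 'p)"
    where "\<pi> n p = (coord_proj (V n) (fst p), coord_proj (V n) (snd p))" for n p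
  have eq: "product_uncertainty V A = (\<Inter>n. \<pi> n -` A n)"
    by (auto simp: product_uncertainty_def \<pi>_def)
  have "continuous_on UNIV (\<lambda>x::real ^ 'p. if i \<in> V n then x $ i else 0)" for i n
    by (cases "i \<in> V n"; simp add: continuous_on_component)
  then have "continuous_on UNIV (coord_proj (V n))" for n
    unfolding coord_proj_def by (rule continuous_on_vec_lambda)
  then have "continuous_on UNIV (\<pi> n)" for n
    unfolding \<pi>_def by (intro continuous_on_Pair;
      rule continuous_on_compose2[of UNIV "coord_proj (V n)"])
      (simp_all add: continuous_on_fst continuous_on_snd)
  then have "closed (\<pi> n -` A n)" for n
    using compact_imp_closed[OF compact] by (intro closed_vimage)
  then have "closed (product_uncertainty V A)"
    unfolding eq by blast
  moreover have "bounded (product_uncertainty V A)"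
  proof -
    obtain B where B: "\<And>n s. s \<in> A n \<Longrightarrow> norm s \<le> B n"
      using compact[THEN compact_imp_bounded] unfolding bounded_iff by metis
    have "norm p \<le> (\<Sum>n\<in>UNIV. B n)" if "p \<in> product_uncertainty V A" for p
    proof -
      have "p = (\<Sum>n\<in>UNIV. \<pi> n p)"
        using assms(1,2) by (simp add: \<pi>_def prod_eq_iff fst_sum snd_sum coord_proj_sum)
      then have "norm p = norm (\<Sum>n\<in>UNIV. \<pi> n p)"
        by simp
      also have "\<dots> \<le> (\<Sum>n\<in>UNIV. B n)"
        using that by (intro sum_norm_le B) (auto simp: eq)
      finally show ?thesis .
    qed
    then show ?thesis
      unfolding bounded_iff by blast
  qed
  ultimately show ?thesis
    by (simp add: compact_eq_bounded_closed)
qed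

section \<open>The partition-wise pricing problem\<close>

theorem theorem3:
  fixes V :: "'n::finite \<Rightarrow> 'p::finite set"
    and c :: "real ^ 'p"
    and G :: "'n \<Rightarrow> real ^ 'p \<Rightarrow> real"
    and A :: "'n \<Rightarrow> ((real ^ 'p) \<times> (real ^ 'p)) set"
    and z :: "real ^ 'n"
  assumes V_nonempty: "\<And>n. V n \<noteq> {}"
    and V_disjoint: "disjoint_family V"
    and V_cover: "(\<Union>n. V n) = UNIV"
    and G_cpgf: "\<And>n. cpgf (V n) (G n)"
    and A_space: "\<And>n. A n \<subseteq> coord_space (V n) \<times> coord_space (V n)"
    and A_nonempty: "\<And>n. A n \<noteq> {}"
    and A_convex: "\<And>n. convex (A n)"
    and A_compact: "\<And>n. compact (A n)"
    and b_equal: "\<And>n a b i j. (a, b) \<in> A n \<Longrightarrow> i \<in> V n \<Longrightarrow> j \<in> V n \<Longrightarrow> b $ i = b $ j"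
    and b_pos: "\<And>n a b i. (a, b) \<in> A n \<Longrightarrow> i \<in> V n \<Longrightarrow> 0 < b $ i"
  shows "is_arg_max (robust_objective V c G A) (\<lambda>_. True) z \<longleftrightarrow>
         is_arg_max (worst_G_objective V c G A) (\<lambda>_. True) z"
proof -
  define g where "g n x s = G n (utility_vec (V n) c x (fst s) (snd s))" for n x s
  define P where "P = product_uncertainty V A"
  have g_pos: "0 < g n x s" for n x s
    using cpgf_pos[OF G_cpgf] V_nonempty[of n] utility_vec_in_pos_orthant by (force simp: g_def)
  have g_cont: "continuous_on S (g n x)" for S n x
    unfolding g_def by (rule continuous_on_cpgf_utility_vec[OF G_cpgf])
  \<comment> \<open>This lets the same \<open>g n\<close> be minimised over \<open>A n\<close> and
    evaluated at full scenarios in \<open>P\<close>.\<close>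
  have g_proj: "g n x (coord_proj (V n) (fst s), coord_proj (V n) (snd s)) = g n x s" for n x s
    by (simp add: g_def utility_vec_coord_proj)
  have glue: "\<exists>p\<in>P. \<forall>n. (coord_proj (V n) (fst p), coord_proj (V n) (snd p)) = s n"
    if "\<And>n. s n \<in> A n" for s
    unfolding P_def using V_disjoint A_space that by (rule product_uncertainty_glue)
  have P_compact: "compact P"
    unfolding P_def using V_disjoint V_cover A_compact by (rule compact_product_uncertainty)
  have P_nonempty: "P \<noteq> {}"
    using glue[of "\<lambda>n. SOME s. s \<in> A n"] A_nonempty some_in_eq by blast
  have rev_cont: "continuous_on P (\<lambda>s. revenue z (\<lambda>n. g n (z $ n) s))" for z
  proof -
    have "1 + (\<Sum>n\<in>UNIV. g n (z $ n) s) \<noteq> 0" for s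
      using g_pos by (simp add: add_pos_nonneg sum_nonneg less_imp_le less_imp_neq[THEN not_sym])
    then show ?thesis
      unfolding revenue_def by (intro continuous_intros g_cont) auto
  qed
  have R: "robust_objective V c G A z = min_over P (\<lambda>s. revenue z (\<lambda>n. g n (z $ n) s))" for z
    by (simp add: robust_objective_def P_def revenue_def g_def case_prod_unfold)
  define w where "w n x = min_over (A n) (g n x)" for n x
  have W: "worst_G_objective V c G A z = revenue z (\<lambda>n. w n (z $ n))" for z
    by (simp add: worst_G_objective_def worst_G_def w_def revenue_def g_def[abs_def] case_prod_unfold)
  have w_attained: "\<exists>p\<in>P. \<forall>n. w n (z $ n) = g n (z $ n) p" for z
  proof -
    \<comment> \<open>A minimiser is picked in each block separately; gluing these yields one
      scenario of \<open>P\<close>.\<close>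
    have "\<exists>s. s \<in> A n \<and> w n (z $ n) = g n (z $ n) s" for n
      using min_over_attained[OF A_compact A_nonempty g_cont] unfolding w_def by blast
    then obtain s where "\<And>n. s n \<in> A n" "\<And>n. w n (z $ n) = g n (z $ n) (s n)"
      by metis
    then show ?thesis
      using glue[of s] g_proj by metis
  qed
  have w_le: "w n x \<le> g n x s" if "s \<in> P" for n x s
    using min_over_le[OF A_compact A_nonempty g_cont,
        of "(coord_proj (V n) (fst s), coord_proj (V n) (snd s))" n n x] that
    by (auto simp: w_def P_def g_proj product_uncertainty_def)
  show ?thesis
    unfolding W[abs_def]
  proof (rule is_arg_max_min_revenue_iff[where g = g and P = P])
    show "\<exists>s\<in>P. robust_objective V c G A z = revenue z (\<lambda>n. g n (z $ n) s)" for z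
      unfolding R by (rule min_over_attained[OF P_compact P_nonempty rev_cont])
    show "robust_objective V c G A z \<le> revenue z (\<lambda>n. g n (z $ n) s)" if "s \<in> P" for z s
      unfolding R using P_compact P_nonempty rev_cont that by (rule min_over_le)
  qed (rule g_pos w_attained w_le | assumption)+
qed

end
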